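(* Let $R$ be a commutative ring and let $\mathcal M$, $\mathcal P$, $\mathcal P'$ satisfy conditions (1)–(5) of the context. Let $p$ be a cofunctorial pair operation defined on $\mathcal P$. Then one can define a cohereditary, cofunctorial pair operation $p_{\mathrm c}$ on $\mathcal P'$ as follows: for $(L,M)\in\mathcal P'$, let $\pi:P\to M$ be a surjection in $\mathcal M$ with $P$ projective such that $(\pi^{-1}(L),P)\in\mathcal P$, and set $$p_{\mathrm c}(L,M):=\pi(p(\pi^{-1}(L),P)).$$ (In particular this is independent of the choice of $\pi$ and $P$.) Moreover, if $p$ is a cohereditary, cofunctorial pair operation defined on $\mathcal P'$, then $p_{\mathrm c}=p$.
   Context: Setting: (1) $\mathcal M$ is an abelian category of $R$-modules (and $R$-linear maps) that has enough projectives. Submodule inclusions, quotient maps, kernels, images and cokernels in $\mathcal M$ are the usual module-theoretic ones; "projective" means projective in $\mathcal M$ (e.g. graded projective if $\mathcal M$ consists of graded modules); all homomorphisms are morphisms of $\mathcal M$. (2) $\mathcal P$ is a set of pairs $(N,P)$ with $N\subseteq P$, $N,P\in\mathcal M$, and $P$ projective. (3) $\mathcal P'$ is a set of pairs $(L,M)$ of modules in $\mathcal M$ with $L\subseteq M$ such that $\mathcal P\subseteq\mathcal P'$ and for every $(L,M)\in\mathcal P'$ there are a projective module $P\in\mathcal M$ and a surjection $\pi:P\to M$ in $\mathcal M$ with $(\pi^{-1}(L),P)\in\mathcal P$. (4) If $(L,M),(N,M)\in\mathcal P'$ with $L\subseteq N$, then there exists a surjection $\pi:P\twoheadrightarrow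 M$ in $\mathcal M$, $P$ projective, such that $(\pi^{-1}(L),P),(\pi^{-1}(N),P)\in\mathcal P$. (5) Given $L,M,P,\pi$ as in (3), if $\phi:M\to N$ is a surjection in $\mathcal M$, $q:Q\to N$ is a surjection in $\mathcal M$ from a projective module $Q$ with $(q^{-1}(\phi(L)),Q)\in\mathcal P$, and $\tilde\phi:P\to Q$ is any map in $\mathcal M$ with $\phi\circ\pi=q\circ\tilde\phi$, then $(\tilde\phi(\pi^{-1}(L)),Q)\in\mathcal P$. Both $\mathcal P$ and $\mathcal P'$ are closed under isomorphism: if $(L,M)$ is in the class and $\phi:M\to M'$ is an isomorphism in $\mathcal M$, then $(\phi(L),M')$ is in the class. A pair operation on such a class is a function $p$ sending each pair $(L,M)$ in it to a submodule $p(L,M)$ of $M$ with $\phi(p(L,M))=p(\phi(L),M')$ for every isomorphism $\phi:M\to M'$ in $\mathcal M$. It is cofunctorial if $p(g^{-1}(L),M)\subseteq g^{-1}(p(L,M'))$ whenever $g:M\to M'$ is in $\mathcal M$ and $(L,M'),(g^{-1}(L),M)$ are in the class; it is cohereditary if $p(N/L,M/L)=\frac{p(N,M)+L}{L}$ whenever $L\subseteq N\subseteq M$ and $(N,M),(N/L,M/L)$ are in the class. *)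

theory Defs
  imports "HOL-Algebra.Module" "HOL-Algebra.AbelCoset" "HOL-Library.FuncSet"
begin

section \<open>Categories of modules\<close>

text \<open>
  A category of modules is given by a set of objects, the underlying module of each object, and
  sets of morphisms, which are linear maps between the underlying modules. Objects are kept apart
  from their underlying modules because a module may carry further structure (for instance a
  grading) in several ways. Morphisms are \<^const>\<open>extensional\<close>, so that HOL equality of functions
  is equality of morphisms.
\<close>

record ('o, 'a, 'm) module_cat =
  Obj :: "'o set"
  Und :: "'o \<Rightarrow> ('a, 'm) module"
  Hom :: "'o \<Rightarrow> 'o \<Rightarrow> ('m \<Rightarrow> 'm) set"

definition linear_maps ::
  "('a, 'r) ring_scheme \<Rightarrow> ('a, 'm) module \<Rightarrow> ('a, 'm) module \<Rightarrow> ('m \<Rightarrow> 'm) set" where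
  "linear_maps R X Y =
     {f \<in> carrier X \<rightarrow>\<^sub>E carrier Y.
        (\<forall>x\<in>carrier X. \<forall>y\<in>carrier X. f (x \<oplus>\<^bsub>X\<^esub> y) = f x \<oplus>\<^bsub>Y\<^esub> f y) \<and>
        (\<forall>a\<in>carrier R. \<forall>x\<in>carrier X. f (a \<odot>\<^bsub>X\<^esub> x) = a \<odot>\<^bsub>Y\<^esub> f x)}"

abbreviation car :: "('o, 'a, 'm) module_cat \<Rightarrow> 'o \<Rightarrow> 'm set" where
  "car C X \<equiv> carrier (Und C X)"

definition arr :: "('o, 'a, 'm) module_cat \<Rightarrow> 'o \<Rightarrow> 'o \<Rightarrow> ('m \<Rightarrow> 'm) \<Rightarrow> bool" where
  "arr C X Y f \<longleftrightarrow> X \<in> Obj C \<and> Y \<in> Obj C \<and> f \<in> Hom C X Y"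

text \<open>\<open>cmp C X g f\<close> is the composite of \<open>f\<close> followed by \<open>g\<close>, where \<open>X\<close> is the domain of \<open>f\<close>.\<close>

definition cmp ::
  "('o, 'a, 'm) module_cat \<Rightarrow> 'o \<Rightarrow> ('m \<Rightarrow> 'm) \<Rightarrow> ('m \<Rightarrow> 'm) \<Rightarrow> ('m \<Rightarrow> 'm)" where
  "cmp C X g f = compose (car C X) g f"

definition idm :: "('o, 'a, 'm) module_cat \<Rightarrow> 'o \<Rightarrow> ('m \<Rightarrow> 'm)" where
  "idm C X = (\<lambda>x\<in>car C X. x)"

definition zerom :: "('o, 'a, 'm) module_cat \<Rightarrow> 'o \<Rightarrow> 'o \<Rightarrow> ('m \<Rightarrow> 'm)" where
  "zerom C X Y = (\<lambda>x\<in>car C X. \<zero>\<^bsub>Und C Y\<^esub>)"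

definition addm ::
  "('o, 'a, 'm) module_cat \<Rightarrow> 'o \<Rightarrow> 'o \<Rightarrow> ('m \<Rightarrow> 'm) \<Rightarrow> ('m \<Rightarrow> 'm) \<Rightarrow> ('m \<Rightarrow> 'm)" where
  "addm C X Y f g = (\<lambda>x\<in>car C X. f x \<oplus>\<^bsub>Und C Y\<^esub> g x)"

definition negm :: "('o, 'a, 'm) module_cat \<Rightarrow> 'o \<Rightarrow> 'o \<Rightarrow> ('m \<Rightarrow> 'm) \<Rightarrow> ('m \<Rightarrow> 'm)" where
  "negm C X Y f = (\<lambda>x\<in>car C X. \<ominus>\<^bsub>Und C Y\<^esub> f x)"

locale module_category = cring R for R (structure) +
  fixes C :: "('o, 'a, 'm) module_cat"
  assumes Und_module: "X \<in> Obj C \<Longrightarrow> module R (Und C X)"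
    and Hom_linear: "arr C X Y f \<Longrightarrow> f \<in> linear_maps R (Und C X) (Und C Y)"
    and idm_arr: "X \<in> Obj C \<Longrightarrow> arr C X X (idm C X)"
    and cmp_arr: "arr C X Y f \<Longrightarrow> arr C Y Z g \<Longrightarrow> arr C X Z (cmp C X g f)"


section \<open>Categorical notions\<close>

definition mono_arr where
  "mono_arr C X Y f \<longleftrightarrow> arr C X Y f \<and>
     (\<forall>T a b. arr C T X a \<longrightarrow> arr C T X b \<longrightarrow> cmp C T f a = cmp C T f b \<longrightarrow> a = b)"

definition epi_arr where
  "epi_arr C X Y f \<longleftrightarrow> arr C X Y f \<and>
     (\<forall>T a b. arr C Y T a \<longrightarrow> arr C Y T b \<longrightarrow> cmp C X a f = cmp C X b f \<longrightarrow> a = b)"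

definition iso_arr where
  "iso_arr C X Y f \<longleftrightarrow> arr C X Y f \<and>
     (\<exists>g. arr C Y X g \<and> cmp C X g f = idm C X \<and> cmp C Y f g = idm C Y)"

definition is_kernel where
  "is_kernel C X Y f K k \<longleftrightarrow> arr C K X k \<and> cmp C K f k = zerom C K Y \<and>
     (\<forall>T t. arr C T X t \<longrightarrow> cmp C T f t = zerom C T Y \<longrightarrow>
        (\<exists>!u. arr C T K u \<and> cmp C T k u = t))"

definition is_cokernel where
  "is_cokernel C X Y f Q q \<longleftrightarrow> arr C Y Q q \<and> cmp C X q f = zerom C X Q \<and>
     (\<forall>T t. arr C Y T t \<longrightarrow> cmp C X t f = zerom C X T \<longrightarrow>
        (\<exists>!u. arr C Q T u \<and> cmp C Y u q = t))"

definition is_zero_obj where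
  "is_zero_obj C Z \<longleftrightarrow> Z \<in> Obj C \<and>
     (\<forall>X\<in>Obj C. (\<exists>!f. arr C Z X f) \<and> (\<exists>!f. arr C X Z f))"

definition is_product where
  "is_product C X Y Z p q \<longleftrightarrow> arr C Z X p \<and> arr C Z Y q \<and>
     (\<forall>T f g. arr C T X f \<longrightarrow> arr C T Y g \<longrightarrow>
        (\<exists>!u. arr C T Z u \<and> cmp C T p u = f \<and> cmp C T q u = g))"

definition is_coproduct where
  "is_coproduct C X Y Z i j \<longleftrightarrow> arr C X Z i \<and> arr C Y Z j \<and>
     (\<forall>T f g. arr C X T f \<longrightarrow> arr C Y T g \<longrightarrow>
        (\<exists>!u. arr C Z T u \<and> cmp C X u i = f \<and> cmp C Y u j = g))"

definition projective where
  "projective C P \<longleftrightarrow> P \<in> Obj C \<and>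
     (\<forall>X Y e f. epi_arr C X Y e \<longrightarrow> arr C P Y f \<longrightarrow> (\<exists>h. arr C P X h \<and> cmp C P e h = f))"

definition enough_projectives where
  "enough_projectives C \<longleftrightarrow> (\<forall>X\<in>Obj C. \<exists>P e. projective C P \<and> epi_arr C P X e)"


section \<open>Abelian categories of modules\<close>

text \<open>
  \<open>submod C X L\<close>: the set \<open>L\<close> is a submodule of \<open>X\<close> in the category, that is, the carrier of an
  object whose inclusion into \<open>X\<close> is a morphism. (Linearity of the inclusion makes the operations
  of that object the restrictions of those of \<open>X\<close>.)
\<close>

definition submod :: "('o, 'a, 'm) module_cat \<Rightarrow> 'o \<Rightarrow> 'm set \<Rightarrow> bool" where
  "submod C X L \<longleftrightarrow> (\<exists>K. car C K = L \<and> L \<subseteq> car C X \<and> arr C K X (idm C K))"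

definition surj_arr :: "('o, 'a, 'm) module_cat \<Rightarrow> 'o \<Rightarrow> 'o \<Rightarrow> ('m \<Rightarrow> 'm) \<Rightarrow> bool" where
  "surj_arr C X Y f \<longleftrightarrow> arr C X Y f \<and> f ` car C X = car C Y"

definition preim :: "('o, 'a, 'm) module_cat \<Rightarrow> 'o \<Rightarrow> ('m \<Rightarrow> 'm) \<Rightarrow> 'm set \<Rightarrow> 'm set" where
  "preim C X f L = {x \<in> car C X. f x \<in> L}"

text \<open>
  \<open>is_quotient C X L Q q\<close>: the morphism \<open>q : X \<rightarrow> Q\<close> exhibits \<open>Q\<close> as \<open>X/L\<close>. The module of cosets
  has elements of type \<open>'m set\<close>, so the quotient is taken as an object of the category up to
  isomorphism: \<open>q\<close> is surjective with kernel \<open>L\<close>. For \<open>L \<subseteq> N \<subseteq> X\<close> the submodule \<open>N/L\<close> is then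
  \<open>q ` N\<close>.
\<close>

definition is_quotient ::
  "('o, 'a, 'm) module_cat \<Rightarrow> 'o \<Rightarrow> 'm set \<Rightarrow> 'o \<Rightarrow> ('m \<Rightarrow> 'm) \<Rightarrow> bool" where
  "is_quotient C X L Q q \<longleftrightarrow>
     submod C X L \<and> surj_arr C X Q q \<and> a_kernel (Und C X) (Und C Q) q = L"

text \<open>
  The first six and the last two assumptions, with the universal properties in \<open>kernel\<close> and
  \<open>cokernel\<close>, are the axioms of an abelian category. The remaining parts of \<open>kernel\<close> and
  \<open>cokernel\<close> say that these are the module-theoretic ones; the same then follows for
  monomorphisms, epimorphisms and images.
\<close>

locale abelian_module_category = module_category +
  assumes zerom_arr: "X \<in> Obj C \<Longrightarrow> Y \<in> Obj C \<Longrightarrow> arr C X Y (zerom C X Y)"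
    and addm_arr: "arr C X Y f \<Longrightarrow> arr C X Y g \<Longrightarrow> arr C X Y (addm C X Y f g)"
    and negm_arr: "arr C X Y f \<Longrightarrow> arr C X Y (negm C X Y f)"
    and zero_obj: "\<exists>Z. is_zero_obj C Z"
    and product: "X \<in> Obj C \<Longrightarrow> Y \<in> Obj C \<Longrightarrow> \<exists>Z p q. is_product C X Y Z p q"
    and coproduct: "X \<in> Obj C \<Longrightarrow> Y \<in> Obj C \<Longrightarrow> \<exists>Z i j. is_coproduct C X Y Z i j"
    and kernel: "arr C X Y f \<Longrightarrow>
      \<exists>K. car C K = a_kernel (Und C X) (Und C Y) f \<and> is_kernel C X Y f K (idm C K)"
    and cokernel: "arr C X Y f \<Longrightarrow>
      \<exists>Q q. is_quotient C Y (f ` car C X) Q q \<and> is_cokernel C X Y f Q q"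
    and mono_normal: "mono_arr C X Y f \<Longrightarrow> \<exists>Z g. arr C Y Z g \<and> is_kernel C Y Z g X f"
    and epi_normal: "epi_arr C X Y f \<Longrightarrow> \<exists>Z g. arr C Z X g \<and> is_cokernel C Z X g Y f"


section \<open>Pair operations\<close>

text \<open>A pair \<open>(L, M)\<close> consists of an object \<open>M\<close> and the carrier \<open>L\<close> of a submodule of it.\<close>

definition pair_class :: "('o, 'a, 'm) module_cat \<Rightarrow> ('m set \<times> 'o) set \<Rightarrow> bool" where
  "pair_class C \<P> \<longleftrightarrow>
     (\<forall>(L, M)\<in>\<P>. M \<in> Obj C \<and> submod C M L) \<and>
     (\<forall>L M M' \<phi>. (L, M) \<in> \<P> \<longrightarrow> iso_arr C M M' \<phi> \<longrightarrow> (\<phi> ` L, M') \<in> \<P>)"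

definition pair_operation ::
  "('a, 'r) ring_scheme \<Rightarrow> ('o, 'a, 'm) module_cat \<Rightarrow> ('m set \<times> 'o) set \<Rightarrow>
   ('m set \<times> 'o \<Rightarrow> 'm set) \<Rightarrow> bool" where
  "pair_operation R C \<P> p \<longleftrightarrow>
     (\<forall>(L, M)\<in>\<P>. submodule (p (L, M)) R (Und C M)) \<and>
     (\<forall>L M M' \<phi>. (L, M) \<in> \<P> \<longrightarrow> iso_arr C M M' \<phi> \<longrightarrow> \<phi> ` p (L, M) = p (\<phi> ` L, M'))"

definition cofunctorial ::
  "('o, 'a, 'm) module_cat \<Rightarrow> ('m set \<times> 'o) set \<Rightarrow> ('m set \<times> 'o \<Rightarrow> 'm set) \<Rightarrow> bool" where
  "cofunctorial C \<P> p \<longleftrightarrow>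
     (\<forall>L M M' g. arr C M M' g \<longrightarrow> (L, M') \<in> \<P> \<longrightarrow> (preim C M g L, M) \<in> \<P> \<longrightarrow>
        p (preim C M g L, M) \<subseteq> preim C M g (p (L, M')))"

definition cohereditary ::
  "('o, 'a, 'm) module_cat \<Rightarrow> ('m set \<times> 'o) set \<Rightarrow> ('m set \<times> 'o \<Rightarrow> 'm set) \<Rightarrow> bool" where
  "cohereditary C \<P> p \<longleftrightarrow>
     (\<forall>L N M Q q. is_quotient C M L Q q \<longrightarrow> L \<subseteq> N \<longrightarrow> (N, M) \<in> \<P> \<longrightarrow> (q ` N, Q) \<in> \<P> \<longrightarrow>
        p (q ` N, Q) = q ` (p (N, M) <+>\<^bsub>Und C M\<^esub> L))"

definition presentation ::
  "('o, 'a, 'm) module_cat \<Rightarrow> ('m set \<times> 'o) set \<Rightarrow> 'm set \<Rightarrow> 'o \<Rightarrow> 'o \<Rightarrow> ('m \<Rightarrow> 'm) \<Rightarrow> bool" where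
  "presentation C \<P> L M P \<pi> \<longleftrightarrow>
     projective C P \<and> surj_arr C P M \<pi> \<and> (preim C P \<pi> L, P) \<in> \<P>"

definition cohereditary_version ::
  "('o, 'a, 'm) module_cat \<Rightarrow> ('m set \<times> 'o) set \<Rightarrow> ('m set \<times> 'o \<Rightarrow> 'm set) \<Rightarrow>
   ('m set \<times> 'o \<Rightarrow> 'm set)" where
  "cohereditary_version C \<P> p = (\<lambda>(L, M).
     let (P, \<pi>) = (SOME (P, \<pi>). presentation C \<P> L M P \<pi>) in \<pi> ` p (preim C P \<pi> L, P))"

end

theory Submission
  imports Defs
begin

text \<open>
  If \<open>\<pi> : P \<rightarrow> M\<close> and \<open>\<pi>' : P' \<rightarrow> M'\<close> are presentations and \<open>g : M \<rightarrow> M'\<close>, then projectivity of \<open>P\<close> lifts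
  \<open>g\<close> to \<open>h : P \<rightarrow> P'\<close> with \<open>\<pi>' h = g \<pi>\<close>, and cofunctoriality of \<open>p\<close> along \<open>h\<close> descends to \<open>g\<close>. For
  \<open>g = id\<close> this is independence of the presentation. A presentation of \<open>(N, M)\<close> composed with
  \<open>M \<rightarrow> M/L\<close> is a presentation of \<open>(N/L, M/L)\<close>, so \<open>p\<^sub>c\<close> is cohereditary. Conversely, a
  cohereditary \<open>p\<close> can be evaluated along the quotient \<open>\<pi> : P \<rightarrow> P/ker \<pi>\<close>, which gives \<open>p\<^sub>c = p\<close>.
\<close>

section \<open>Preimages, submodules and elimination rules for pairs and pair operations\<close>

lemma preim_image_eq:
  "surj_arr C X Y f \<Longrightarrow> L \<subseteq> car C Y \<Longrightarrow> f ` preim C X f L = L"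
  by (auto simp: surj_arr_def preim_def image_iff)

lemma submod_subset: "submod C X L \<Longrightarrow> L \<subseteq> car C X"
  by (auto simp: submod_def)

lemma pair_class_submod: "pair_class C \<P> \<Longrightarrow> (L, M) \<in> \<P> \<Longrightarrow> submod C M L"
  by (auto simp: pair_class_def)

lemma pair_class_iso:
  "pair_class C \<P> \<Longrightarrow> (L, M) \<in> \<P> \<Longrightarrow> iso_arr C M M' \<phi> \<Longrightarrow> (\<phi> ` L, M') \<in> \<P>"
  unfolding pair_class_def by blast

lemma pair_operation_submodule:
  "pair_operation R C \<P> p \<Longrightarrow> (L, M) \<in> \<P> \<Longrightarrow> submodule (p (L, M)) R (Und C M)"
  by (auto simp: pair_operation_def)

lemma cofunctorialD:
  "cofunctorial C \<P> p \<Longrightarrow> arr C M M' g \<Longrightarrow> (L, M') \<in> \<P> \<Longrightarrow> (preim C M g L, M) \<in> \<P> \<Longrightarrow>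
    p (preim C M g L, M) \<subseteq> preim C M g (p (L, M'))"
  unfolding cofunctorial_def by blast

lemma cohereditaryD:
  "cohereditary C \<P> p \<Longrightarrow> is_quotient C M L Q q \<Longrightarrow> L \<subseteq> N \<Longrightarrow> (N, M) \<in> \<P> \<Longrightarrow> (q ` N, Q) \<in> \<P> \<Longrightarrow>
    p (q ` N, Q) = q ` (p (N, M) <+>\<^bsub>Und C M\<^esub> L)"
  unfolding cohereditary_def by blast

section \<open>Morphisms as linear maps between the underlying modules\<close>

context module_category
begin

lemma arr_funcset: "arr C X Y f \<Longrightarrow> f \<in> car C X \<rightarrow> car C Y"
  by (drule Hom_linear) (auto simp: linear_maps_def)

lemma arr_extensional: "arr C X Y f \<Longrightarrow> f \<in> extensional (car C X)"
  by (drule Hom_linear) (simp add: linear_maps_def PiE_def)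

lemma arr_closed: "arr C X Y f \<Longrightarrow> x \<in> car C X \<Longrightarrow> f x \<in> car C Y"
  by (rule funcset_mem[OF arr_funcset])

lemma arr_add:
  "arr C X Y f \<Longrightarrow> x \<in> car C X \<Longrightarrow> y \<in> car C X \<Longrightarrow> f (x \<oplus>\<^bsub>Und C X\<^esub> y) = f x \<oplus>\<^bsub>Und C Y\<^esub> f y"
  by (drule Hom_linear) (simp add: linear_maps_def)

lemma arr_smult:
  "arr C X Y f \<Longrightarrow> a \<in> carrier R \<Longrightarrow> x \<in> car C X \<Longrightarrow> f (a \<odot>\<^bsub>Und C X\<^esub> x) = a \<odot>\<^bsub>Und C Y\<^esub> f x"
  by (drule Hom_linear) (simp add: linear_maps_def)

lemma arr_Und_module: "arr C X Y f \<Longrightarrow> module R (Und C X)" "arr C X Y f \<Longrightarrow> module R (Und C Y)"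
  using Und_module by (auto simp: arr_def)

text \<open>Linearity here means compatibility with sums and scalars. Zero is preserved because it
  is the multiple of zero by the scalar zero.\<close>

lemma arr_zero:
  assumes f: "arr C X Y f"
  shows "f \<zero>\<^bsub>Und C X\<^esub> = \<zero>\<^bsub>Und C Y\<^esub>"
proof -
  interpret X: module R "Und C X" using f by (rule arr_Und_module)
  interpret Y: module R "Und C Y" using f by (rule arr_Und_module)
  have "f \<zero>\<^bsub>Und C X\<^esub> = f (\<zero>\<^bsub>R\<^esub> \<odot>\<^bsub>Und C X\<^esub> \<zero>\<^bsub>Und C X\<^esub>)" by simp
  also have "\<dots> = \<zero>\<^bsub>Und C Y\<^esub>"
    using arr_smult[OF f] arr_closed[OF f] by (metis X.zero_closed Y.smult_l_null zero_closed)
  finally show ?thesis .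
qed

lemma arr_neg:
  assumes f: "arr C X Y f" and x: "x \<in> car C X"
  shows "f (\<ominus>\<^bsub>Und C X\<^esub> x) = \<ominus>\<^bsub>Und C Y\<^esub> f x"
proof -
  interpret X: module R "Und C X" using f by (rule arr_Und_module)
  interpret Y: module R "Und C Y" using f by (rule arr_Und_module)
  have "f (\<ominus>\<^bsub>Und C X\<^esub> x) \<oplus>\<^bsub>Und C Y\<^esub> f x = f (\<ominus>\<^bsub>Und C X\<^esub> x \<oplus>\<^bsub>Und C X\<^esub> x)"
    using arr_add[OF f] x by simp
  also have "\<dots> = \<zero>\<^bsub>Und C Y\<^esub>" using x arr_zero[OF f] by (simp add: X.l_neg)
  finally show ?thesis using arr_closed[OF f] x by (simp add: Y.minus_equality)
qed

text \<open>Values of the cohereditary version are images of values of \<open>p\<close>; this makes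
  them submodules.\<close>

lemma submodule_image:
  assumes f: "arr C X Y f" and H: "submodule H R (Und C X)"
  shows "submodule (f ` H) R (Und C Y)"
proof -
  interpret X: module R "Und C X" using f by (rule arr_Und_module)
  interpret Y: module R "Und C Y" using f by (rule arr_Und_module)
  note HE = X.submoduleE[OF H]
  have inX: "x \<in> car C X" if "x \<in> H" for x using HE(1) that by blast
  have "\<zero>\<^bsub>Und C X\<^esub> \<in> H" using H by (simp add: submodule_def subgroup_def)
  then have zero: "\<zero>\<^bsub>Und C Y\<^esub> \<in> f ` H" using arr_zero[OF f] by (metis imageI)
  show ?thesis
  proof (rule Y.submoduleI)
    show "f ` H \<subseteq> car C Y" using inX arr_closed[OF f] by blast
  next
    fix a assume "a \<in> f ` H"
    then obtain x where x: "x \<in> H" "a = f x" by blast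
    then have "\<ominus>\<^bsub>Und C Y\<^esub> a = f (\<ominus>\<^bsub>Und C X\<^esub> x)" using arr_neg[OF f] inX by simp
    then show "\<ominus>\<^bsub>Und C Y\<^esub> a \<in> f ` H" using HE(3)[OF x(1)] by simp
  next
    fix a b assume "a \<in> f ` H" "b \<in> f ` H"
    then obtain x y where x: "x \<in> H" "a = f x" and y: "y \<in> H" "b = f y" by blast
    then have "a \<oplus>\<^bsub>Und C Y\<^esub> b = f (x \<oplus>\<^bsub>Und C X\<^esub> y)" using arr_add[OF f] inX by simp
    then show "a \<oplus>\<^bsub>Und C Y\<^esub> b \<in> f ` H" using HE(5)[OF x(1) y(1)] by simp
  next
    fix a y assume a: "a \<in> carrier R" and "y \<in> f ` H"
    then obtain x where x: "x \<in> H" "y = f x" by blast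
    then have "a \<odot>\<^bsub>Und C Y\<^esub> y = f (a \<odot>\<^bsub>Und C X\<^esub> x)" using arr_smult[OF f a] inX by simp
    then show "a \<odot>\<^bsub>Und C Y\<^esub> y \<in> f ` H" using HE(4)[OF a x(1)] by simp
  qed (rule zero)
qed

text \<open>\<open>submod\<close> provides an object on \<open>L\<close> whose inclusion is a
  morphism. That inclusion sends the zero of the object to the zero of \<open>X\<close>, which
  therefore lies in \<open>L\<close>.\<close>

lemma submod_zero:
  assumes "submod C X L"
  shows "\<zero>\<^bsub>Und C X\<^esub> \<in> L"
proof -
  obtain K where K: "car C K = L" "arr C K X (idm C K)" using assms by (auto simp: submod_def)
  interpret K: module R "Und C K" using K(2) by (rule arr_Und_module)
  show ?thesis using arr_zero[OF K(2)] K(1) K.zero_closed by (simp add: idm_def)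
qed

text \<open>Morphisms that agree after \<open>f\<close> agree on every value of \<open>f\<close>,
  hence on all of \<open>Y\<close>, and extensionality makes them equal. Projectivity speaks of
  epimorphisms and presentations of surjections; this connects the two.\<close>

lemma surj_arr_epi:
  assumes "surj_arr C X Y f"
  shows "epi_arr C X Y f"
  unfolding epi_arr_def
proof (intro conjI allI impI)
  show "arr C X Y f" using assms by (simp add: surj_arr_def)
next
  fix T a b
  assume a: "arr C Y T a" and b: "arr C Y T b" and eq: "cmp C X a f = cmp C X b f"
  show "a = b"
  proof (rule extensionalityI[OF arr_extensional[OF a] arr_extensional[OF b]])
    fix y assume "y \<in> car C Y"
    then obtain x where x: "x \<in> car C X" "y = f x" using assms by (auto simp: surj_arr_def)
    then show "a y = b y" using fun_cong[OF eq, of x] by (simp add: cmp_def compose_def)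
  qed
qed

section \<open>Composites, isomorphisms and preimages\<close>

lemma cmp_apply: "x \<in> car C X \<Longrightarrow> cmp C X g f x = g (f x)"
  by (simp add: cmp_def compose_def)

lemma iso_arr_bij_betw:
  assumes f: "iso_arr C X Y f"
  shows "bij_betw f (car C X) (car C Y)"
proof -
  obtain g where g: "arr C Y X g" "cmp C X g f = idm C X" "cmp C Y f g = idm C Y"
    using f by (auto simp: iso_arr_def)
  show ?thesis
  proof (rule bij_betw_byWitness[where f' = g])
    show "\<forall>x\<in>car C X. g (f x) = x"
      using fun_cong[OF g(2)] by (metis cmp_apply idm_def restrict_apply')
    show "\<forall>y\<in>car C Y. f (g y) = y"
      using fun_cong[OF g(3)] by (metis cmp_apply idm_def restrict_apply')
    show "f ` car C X \<subseteq> car C Y" using f arr_closed by (auto simp: iso_arr_def)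
    show "g ` car C Y \<subseteq> car C X" using arr_closed[OF g(1)] by blast
  qed
qed

lemma iso_arr_surj_arr: "iso_arr C X Y f \<Longrightarrow> surj_arr C X Y f"
  using iso_arr_bij_betw[of X Y f] by (simp add: surj_arr_def iso_arr_def bij_betw_def)

lemma preim_cmp:
  "arr C X Y f \<Longrightarrow> preim C X (cmp C X g f) L = preim C X f (preim C Y g L)"
  by (auto simp: preim_def cmp_apply arr_closed)

lemma surj_arr_cmp:
  assumes f: "surj_arr C X Y f" and g: "surj_arr C Y Z g"
  shows "surj_arr C X Z (cmp C X g f)"
proof -
  have "cmp C X g f ` car C X = g ` f ` car C X" by (force simp: cmp_apply)
  then show ?thesis using f g cmp_arr[of X Y f Z g] by (simp add: surj_arr_def)
qed

section \<open>Presentations and their comparison\<close>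

lemma presentation_cmp:
  assumes "presentation C \<P> N M P \<pi>" and q: "surj_arr C M Q q" and pre: "preim C M q (q ` N) = N"
  shows "presentation C \<P> (q ` N) Q P (cmp C P q \<pi>)"
  \<comment> \<open>By \<open>pre\<close>, the set \<open>N\<close> is a union of fibres of
    \<open>q\<close>. So the preimage under the composite of the image of \<open>N\<close> is the
    preimage of \<open>N\<close> under \<open>\<pi>\<close>, and the same pair of
    \<open>\<P>\<close> serves both presentations.\<close>
  using assms surj_arr_cmp[of P M \<pi> Q q] preim_cmp[of P M \<pi> q "q ` N"]
  by (simp add: presentation_def surj_arr_def)

text \<open>Stated for general \<open>g\<close> so that it yields both independence of the
  presentation, with \<open>g\<close> the identity, and cofunctoriality of the cohereditary
  version.\<close>

lemma presentation_image_le: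
  assumes cof: "cofunctorial C \<P> p" and g: "arr C M M' g"
    and P: "presentation C \<P> (preim C M g L) M P \<pi>" and P': "presentation C \<P> L M' P' \<pi>'"
  shows "g ` \<pi> ` p (preim C P \<pi> (preim C M g L), P) \<subseteq> \<pi>' ` p (preim C P' \<pi>' L, P')"
proof -
  have \<pi>: "arr C P M \<pi>" and \<pi>': "arr C P' M' \<pi>'"
    using P P' by (auto simp: presentation_def surj_arr_def)
  have "epi_arr C P' M' \<pi>'" using P' surj_arr_epi by (auto simp: presentation_def)
  then obtain h where h: "arr C P P' h" "cmp C P \<pi>' h = cmp C P g \<pi>"
    using P cmp_arr[OF \<pi> g] unfolding presentation_def projective_def by blast
  \<comment> \<open>Both sides are the preimage of \<open>L\<close> under the same morphism from
    \<open>P\<close> to \<open>M'\<close>, as the square commutes. The form on the right is the one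
    to which cofunctoriality along \<open>h\<close> applies.\<close>
  have eq: "preim C P \<pi> (preim C M g L) = preim C P h (preim C P' \<pi>' L)"
    using preim_cmp[OF \<pi>, of g L] preim_cmp[OF h(1), of \<pi>' L] h(2) by simp
  have le: "p (preim C P \<pi> (preim C M g L), P) \<subseteq> preim C P h (p (preim C P' \<pi>' L, P'))"
    unfolding eq by (rule cofunctorialD[OF cof h(1)]) (use P P' eq in \<open>auto simp: presentation_def\<close>)
  have "g (\<pi> x) = \<pi>' (h x)" if "x \<in> car C P" for x
    using fun_cong[OF h(2), of x] that by (simp add: cmp_apply)
  then show ?thesis using le by (fastforce simp: preim_def)
qed

lemma preim_idm: "L \<subseteq> car C M \<Longrightarrow> preim C M (idm C M) L = L"
  by (auto simp: preim_def idm_def)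

lemma presentation_image_eq:
  assumes cof: "cofunctorial C \<P> p" and L: "L \<subseteq> car C M"
    and P: "presentation C \<P> L M P \<pi>" and P': "presentation C \<P> L M P' \<pi>'"
    and sub: "\<And>N Q. (N, Q) \<in> \<P> \<Longrightarrow> p (N, Q) \<subseteq> car C Q"
  shows "\<pi> ` p (preim C P \<pi> L, P) = \<pi>' ` p (preim C P' \<pi>' L, P')"
proof -
  have le: "\<rho> ` p (preim C Q \<rho> L, Q) \<subseteq> \<rho>' ` p (preim C Q' \<rho>' L, Q')"
    if Q: "presentation C \<P> L M Q \<rho>" and Q': "presentation C \<P> L M Q' \<rho>'" for Q Q' \<rho> \<rho>'
  proof -
    have \<rho>: "arr C Q M \<rho>" using Q by (simp add: presentation_def surj_arr_def)
    then have idM: "arr C M M (idm C M)" using idm_arr by (auto simp: arr_def)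
    have "p (preim C Q \<rho> L, Q) \<subseteq> car C Q" using sub Q by (simp add: presentation_def)
    \<comment> \<open>\<open>idm\<close> is the identity only on the carrier, being
      \<open>undefined\<close> elsewhere. The bound from \<open>sub\<close> keeps the value of
      \<open>p\<close> in the domain of \<open>\<rho>\<close>, so its image lies in the carrier of
      \<open>M\<close>.\<close>
    then have "idm C M ` \<rho> ` p (preim C Q \<rho> L, Q) = \<rho> ` p (preim C Q \<rho> L, Q)"
      using arr_closed[OF \<rho>] by (force simp: idm_def image_iff)
    then show ?thesis
      using presentation_image_le[OF cof idM, of L Q \<rho> Q' \<rho>'] Q Q' L by (simp add: preim_idm)
  qed
  show ?thesis using le[OF P P'] le[OF P' P] by (rule antisym)
qed

section \<open>Quotients and kernels\<close>

lemma image_add_kernel: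
  assumes q: "arr C M Q q" and A: "A \<subseteq> car C M"
  shows "q ` (A <+>\<^bsub>Und C M\<^esub> a_kernel (Und C M) (Und C Q) q) = q ` A"
proof -
  interpret M: module R "Und C M" using q by (rule arr_Und_module)
  interpret Q: module R "Und C Q" using q by (rule arr_Und_module)
  have ker: "a_kernel (Und C M) (Und C Q) q = {x \<in> car C M. q x = \<zero>\<^bsub>Und C Q\<^esub>}"
    by (simp add: a_kernel_def')
  \<comment> \<open>A kernel summand is mapped to zero, so the sum has no values under
    \<open>q\<close> beyond those on \<open>A\<close>. The reverse inclusion takes zero as the
    kernel summand.\<close>
  have eq: "q (a \<oplus>\<^bsub>Und C M\<^esub> l) = q a" if "a \<in> A" "l \<in> a_kernel (Und C M) (Und C Q) q" for a l
    using that A arr_add[OF q, of a l] arr_closed[OF q, of a] by (auto simp: ker)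
  show ?thesis
  proof
    show "q ` (A <+>\<^bsub>Und C M\<^esub> a_kernel (Und C M) (Und C Q) q) \<subseteq> q ` A"
      using eq by (auto simp: set_add_def')
    have "A \<subseteq> A <+>\<^bsub>Und C M\<^esub> a_kernel (Und C M) (Und C Q) q"
    proof
      fix a assume "a \<in> A"
      moreover have "a \<oplus>\<^bsub>Und C M\<^esub> \<zero>\<^bsub>Und C M\<^esub> = a" using \<open>a \<in> A\<close> A by auto
      moreover have "\<zero>\<^bsub>Und C M\<^esub> \<in> a_kernel (Und C M) (Und C Q) q"
        by (simp add: ker arr_zero[OF q])
      ultimately show "a \<in> A <+>\<^bsub>Und C M\<^esub> a_kernel (Und C M) (Und C Q) q"
        by (force simp: set_add_def')
    qed
    then show "q ` A \<subseteq> q ` (A <+>\<^bsub>Und C M\<^esub> a_kernel (Und C M) (Und C Q) q)" by blast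
  qed
qed

text \<open>If \<open>q x = q n\<close> with \<open>n\<close> in \<open>N\<close>, then
  \<open>x - n\<close> lies in the kernel \<open>L\<close>, hence in \<open>N\<close>, and so does
  \<open>x\<close>.\<close>

lemma preim_image_quotient:
  assumes q: "is_quotient C M L Q q" and N: "submod C M N" and LN: "L \<subseteq> N"
  shows "preim C M q (q ` N) = N"
proof
  have qa: "arr C M Q q" and ker: "a_kernel (Und C M) (Und C Q) q = L"
    using q by (auto simp: is_quotient_def surj_arr_def)
  interpret M: module R "Und C M" using qa by (rule arr_Und_module)
  interpret Q: module R "Und C Q" using qa by (rule arr_Und_module)
  obtain K where K: "car C K = N" "arr C K M (idm C K)" using N by (auto simp: submod_def)
  interpret K: module R "Und C K" using K(2) by (rule arr_Und_module)
  have NM: "N \<subseteq> car C M" using N by (rule submod_subset)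
  show "N \<subseteq> preim C M q (q ` N)" using NM by (auto simp: preim_def)
  show "preim C M q (q ` N) \<subseteq> N"
  proof
    fix x assume "x \<in> preim C M q (q ` N)"
    then obtain n where x: "x \<in> car C M" and n: "n \<in> N" "q x = q n" by (auto simp: preim_def)
    have nM: "n \<in> car C M" using n NM by blast
    have "q (x \<ominus>\<^bsub>Und C M\<^esub> n) = \<zero>\<^bsub>Und C Q\<^esub>"
      using x nM n(2) arr_add[OF qa] arr_neg[OF qa] arr_closed[OF qa nM]
      by (simp add: a_minus_def Q.r_neg)
    then have d: "x \<ominus>\<^bsub>Und C M\<^esub> n \<in> N" using x nM ker LN by (auto simp: a_kernel_def')
    \<comment> \<open>The sum is formed in the object \<open>K\<close> carried by \<open>N\<close>
      and compared with the sum in \<open>M\<close> through the inclusion; this gives closure of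
      \<open>N\<close> under addition.\<close>
    have "(x \<ominus>\<^bsub>Und C M\<^esub> n) \<oplus>\<^bsub>Und C K\<^esub> n = (x \<ominus>\<^bsub>Und C M\<^esub> n) \<oplus>\<^bsub>Und C M\<^esub> n"
      using arr_add[OF K(2), of "x \<ominus>\<^bsub>Und C M\<^esub> n" n] d n(1) K(1) K.a_closed by (simp add: idm_def)
    also have "\<dots> = x" using x nM by (simp add: a_minus_def M.a_assoc M.l_neg)
    finally show "x \<in> N" using K.a_closed[of "x \<ominus>\<^bsub>Und C M\<^esub> n" n] d n(1) K(1) by simp
  qed
qed

end

text \<open>A surjection is its own quotient map. What remains is that its kernel is a
  \<open>submod\<close>, and the \<open>kernel\<close> axiom provides the object for this.\<close>

lemma (in abelian_module_category) surj_arr_is_quotient: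
  assumes "surj_arr C X Y f"
  shows "is_quotient C X (a_kernel (Und C X) (Und C Y) f) Y f"
proof -
  have f: "arr C X Y f" using assms by (simp add: surj_arr_def)
  obtain K where "car C K = a_kernel (Und C X) (Und C Y) f" "arr C K X (idm C K)"
    using kernel[OF f] by (auto simp: is_kernel_def)
  then show ?thesis
    using assms by (auto simp: is_quotient_def submod_def a_kernel_def' intro!: exI[of _ K])
qed

text \<open>\<open>SOME\<close> meets its specification once a presentation exists. The selected one
  may differ from the given one, so it is returned as a new pair.\<close>

lemma cohereditary_version_presentation:
  assumes "presentation C \<P> L M P \<pi>"
  obtains P' \<pi>' where "presentation C \<P> L M P' \<pi>'"
    and "cohereditary_version C \<P> p (L, M) = \<pi>' ` p (preim C P' \<pi>' L, P')"
proof -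
  obtain P' \<pi>' where S: "(SOME (P, \<pi>). presentation C \<P> L M P \<pi>) = (P', \<pi>')" by force
  have "presentation C \<P> L M P' \<pi>'"
    using someI[of "\<lambda>(P, \<pi>). presentation C \<P> L M P \<pi>" "(P, \<pi>)"] assms S by simp
  then show thesis using that S by (simp add: cohereditary_version_def)
qed

section \<open>Independence of the presentation, the properties of the cohereditary version, and its
  agreement with a cohereditary \<open>p\<close>\<close>

theorem proposition4p3:
  fixes R :: "('a, 'r) ring_scheme"
    and C :: "('o, 'a, 'm) module_cat"
    and \<P> \<P>' :: "('m set \<times> 'o) set"
  assumes abelian: "abelian_module_category R C"
    and enough: "enough_projectives C"
    and pairs: "pair_class C \<P>"
    and pairs': "pair_class C \<P>'"
    and proj: "\<And>N P. (N, P) \<in> \<P> \<Longrightarrow> projective C P"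
    and sub: "\<P> \<subseteq> \<P>'"
    and pres: "\<And>L M. (L, M) \<in> \<P>' \<Longrightarrow> \<exists>P \<pi>. presentation C \<P> L M P \<pi>"
    and pres2: "\<And>L N M. (L, M) \<in> \<P>' \<Longrightarrow> (N, M) \<in> \<P>' \<Longrightarrow> L \<subseteq> N \<Longrightarrow>
      \<exists>P \<pi>. projective C P \<and> surj_arr C P M \<pi> \<and>
        (preim C P \<pi> L, P) \<in> \<P> \<and> (preim C P \<pi> N, P) \<in> \<P>"
    and push: "\<And>L M P \<pi> N \<phi> Q q \<phi>'.
      (L, M) \<in> \<P>' \<Longrightarrow> presentation C \<P> L M P \<pi> \<Longrightarrow>
      surj_arr C M N \<phi> \<Longrightarrow>
      projective C Q \<Longrightarrow> surj_arr C Q N q \<Longrightarrow> (preim C Q q (\<phi> ` L), Q) \<in> \<P> \<Longrightarrow>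
      arr C P Q \<phi>' \<Longrightarrow> cmp C P \<phi> \<pi> = cmp C P q \<phi>' \<Longrightarrow>
      (\<phi>' ` preim C P \<pi> L, Q) \<in> \<P>"
  shows "(\<forall>p. pair_operation R C \<P> p \<longrightarrow> cofunctorial C \<P> p \<longrightarrow>
      (\<forall>L M P \<pi>. (L, M) \<in> \<P>' \<longrightarrow> presentation C \<P> L M P \<pi> \<longrightarrow>
         cohereditary_version C \<P> p (L, M) = \<pi> ` p (preim C P \<pi> L, P)) \<and>
      pair_operation R C \<P>' (cohereditary_version C \<P> p) \<and>
      cohereditary C \<P>' (cohereditary_version C \<P> p) \<and>
      cofunctorial C \<P>' (cohereditary_version C \<P> p)) \<and>
    (\<forall>p. pair_operation R C \<P>' p \<longrightarrow> cofunctorial C \<P>' p \<longrightarrow> cohereditary C \<P>' p \<longrightarrow>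
      (\<forall>(L, M)\<in>\<P>'. cohereditary_version C \<P> p (L, M) = p (L, M)))"
proof -
  interpret abelian_module_category R C by (rule abelian)
  have subM: "L \<subseteq> car C M" if "(L, M) \<in> \<P>'" for L M
    using pair_class_submod[OF pairs' that] by (rule submod_subset)
  \<comment> \<open>The presentation selected by \<open>SOME\<close> is compared with an arbitrary
    one. Values of \<open>p\<close> are submodules, which supplies the carrier bound for the
    comparison.\<close>
  have indep: "cohereditary_version C \<P> p (L, M) = \<pi> ` p (preim C P \<pi> L, P)"
    if p: "pair_operation R C \<P> p" and cof: "cofunctorial C \<P> p" and LM: "(L, M) \<in> \<P>'"
      and P: "presentation C \<P> L M P \<pi>" for p L M P \<pi>
  proof -
    obtain P' \<pi>' where P': "presentation C \<P> L M P' \<pi>'"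
      "cohereditary_version C \<P> p (L, M) = \<pi>' ` p (preim C P' \<pi>' L, P')"
      using cohereditary_version_presentation[OF P] .
    have "p (N, Q) \<subseteq> car C Q" if "(N, Q) \<in> \<P>" for N Q
    proof -
      have "Q \<in> Obj C" using proj[OF that] by (simp add: projective_def)
      from module.submoduleE(1)[OF Und_module[OF this] pair_operation_submodule[OF p that]]
      show ?thesis .
    qed
    then show ?thesis using presentation_image_eq[OF cof subM[OF LM] P'(1) P] P'(2) by simp
  qed
  \<comment> \<open>The condition \<open>pre\<close> is shared by isomorphisms and by quotients with
    kernel inside \<open>N\<close>, so this formula serves both isomorphism invariance and
    cohereditariness.\<close>
  have image: "cohereditary_version C \<P> p (q ` N, Q) = q ` cohereditary_version C \<P> p (N, M)"
    if p: "pair_operation R C \<P> p" and cof: "cofunctorial C \<P> p" and N: "(N, M) \<in> \<P>'"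
      and N': "(q ` N, Q) \<in> \<P>'" and q: "surj_arr C M Q q" and pre: "preim C M q (q ` N) = N"
    for p q N M Q
  proof -
    obtain P \<pi> where P: "presentation C \<P> N M P \<pi>" using pres[OF N] by blast
    then have \<pi>: "arr C P M \<pi>" and PP: "(preim C P \<pi> N, P) \<in> \<P>"
      by (auto simp: presentation_def surj_arr_def)
    have PC: "p (preim C P \<pi> N, P) \<subseteq> car C P"
      by (rule module.submoduleE(1)[OF arr_Und_module(1)[OF \<pi>] pair_operation_submodule[OF p PP]])
    have "cohereditary_version C \<P> p (q ` N, Q) = cmp C P q \<pi> ` p (preim C P \<pi> N, P)"
      using indep[OF p cof N' presentation_cmp[OF P q pre]] preim_cmp[OF \<pi>, of q "q ` N"] pre
      by simp
    also have "\<dots> = q ` \<pi> ` p (preim C P \<pi> N, P)"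
      using PC by (force simp: cmp_apply image_iff)
    finally show ?thesis using indep[OF p cof N P] by simp
  qed
  have submod_pc: "submodule (cohereditary_version C \<P> p (L, M)) R (Und C M)"
    if p: "pair_operation R C \<P> p" and cof: "cofunctorial C \<P> p" and LM: "(L, M) \<in> \<P>'" for p L M
  proof -
    obtain P \<pi> where P: "presentation C \<P> L M P \<pi>" using pres[OF LM] by blast
    then have "arr C P M \<pi>" "(preim C P \<pi> L, P) \<in> \<P>"
      by (auto simp: presentation_def surj_arr_def)
    then show ?thesis
      using indep[OF p cof LM P] submodule_image pair_operation_submodule[OF p] by simp
  qed
  have pair_op: "pair_operation R C \<P>' (cohereditary_version C \<P> p)"
    if p: "pair_operation R C \<P> p" and cof: "cofunctorial C \<P> p" for p
    unfolding pair_operation_def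
  proof (intro conjI allI impI ballI)
    fix LM assume "LM \<in> \<P>'"
    then show "case LM of (L, M) \<Rightarrow> submodule (cohereditary_version C \<P> p (L, M)) R (Und C M)"
      using submod_pc[OF p cof] by (cases LM) simp
  next
    fix L M M' \<phi> assume LM: "(L, M) \<in> \<P>'" and \<phi>: "iso_arr C M M' \<phi>"
    \<comment> \<open>An isomorphism is injective, so every subset of the carrier of
      \<open>M\<close> is a union of its fibres.\<close>
    have "preim C M \<phi> (\<phi> ` L) = L"
      using subM[OF LM] iso_arr_bij_betw[OF \<phi>] by (auto simp: preim_def bij_betw_def inj_on_def)
    then show "\<phi> ` cohereditary_version C \<P> p (L, M) = cohereditary_version C \<P> p (\<phi> ` L, M')"
      using image[OF p cof LM pair_class_iso[OF pairs' LM \<phi>] iso_arr_surj_arr[OF \<phi>]] by simp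
  qed
  have cohered: "cohereditary C \<P>' (cohereditary_version C \<P> p)"
    if p: "pair_operation R C \<P> p" and cof: "cofunctorial C \<P> p" for p
    unfolding cohereditary_def
  proof (intro allI impI)
    fix L N M Q q
    assume q: "is_quotient C M L Q q" and LN: "L \<subseteq> N"
      and N: "(N, M) \<in> \<P>'" and N': "(q ` N, Q) \<in> \<P>'"
    have qs: "surj_arr C M Q q" and qa: "arr C M Q q" and ker: "a_kernel (Und C M) (Und C Q) q = L"
      using q by (auto simp: is_quotient_def surj_arr_def)
    have "cohereditary_version C \<P> p (N, M) \<subseteq> car C M"
      by (rule module.submoduleE(1)[OF arr_Und_module(1)[OF qa] submod_pc[OF p cof N]])
    \<comment> \<open>\<open>L\<close> is the kernel of \<open>q\<close>, so it disappears under
      \<open>q\<close> and the claim reduces to \<open>image\<close>.\<close>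
    then have "q ` (cohereditary_version C \<P> p (N, M) <+>\<^bsub>Und C M\<^esub> L) =
        q ` cohereditary_version C \<P> p (N, M)"
      using image_add_kernel[OF qa] ker by simp
    then show "cohereditary_version C \<P> p (q ` N, Q) =
        q ` (cohereditary_version C \<P> p (N, M) <+>\<^bsub>Und C M\<^esub> L)"
      using image[OF p cof N N' qs preim_image_quotient[OF q pair_class_submod[OF pairs' N] LN]]
      by simp
  qed
  have cofun: "cofunctorial C \<P>' (cohereditary_version C \<P> p)"
    if p: "pair_operation R C \<P> p" and cof: "cofunctorial C \<P> p" for p
    unfolding cofunctorial_def
  proof (intro allI impI)
    fix L M M' g
    assume g: "arr C M M' g" and L: "(L, M') \<in> \<P>'" and gL: "(preim C M g L, M) \<in> \<P>'"
    obtain P \<pi> where P: "presentation C \<P> (preim C M g L) M P \<pi>" using pres[OF gL] by blast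
    obtain P' \<pi>' where P': "presentation C \<P> L M' P' \<pi>'" using pres[OF L] by blast
    \<comment> \<open>By independence both values may be computed from arbitrary presentations, to
      which the comparison along \<open>g\<close> applies. Membership in the carrier, the other half
      of \<open>preim\<close>, is supplied next.\<close>
    have "g ` cohereditary_version C \<P> p (preim C M g L, M) \<subseteq> cohereditary_version C \<P> p (L, M')"
      using presentation_image_le[OF cof g P P'] indep[OF p cof gL P] indep[OF p cof L P'] by simp
    moreover have "cohereditary_version C \<P> p (preim C M g L, M) \<subseteq> car C M"
      by (rule module.submoduleE(1)[OF arr_Und_module(1)[OF g] submod_pc[OF p cof gL]])
    ultimately show "cohereditary_version C \<P> p (preim C M g L, M)
        \<subseteq> preim C M g (cohereditary_version C \<P> p (L, M'))"
      by (auto simp: preim_def)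
  qed
  have unique: "cohereditary_version C \<P> p (L, M) = p (L, M)"
    if p: "pair_operation R C \<P>' p" and coh: "cohereditary C \<P>' p" and LM: "(L, M) \<in> \<P>'" for p L M
  proof -
    obtain P\<^sub>0 \<pi>\<^sub>0 where "presentation C \<P> L M P\<^sub>0 \<pi>\<^sub>0" using pres[OF LM] by blast
    \<comment> \<open>This is the presentation selected in the definition, so the value of the
      cohereditary version is read off from it.\<close>
    then obtain P \<pi> where P: "presentation C \<P> L M P \<pi>"
      and eq: "cohereditary_version C \<P> p (L, M) = \<pi> ` p (preim C P \<pi> L, P)"
      using cohereditary_version_presentation by metis
    have \<pi>s: "surj_arr C P M \<pi>" and \<pi>: "arr C P M \<pi>" and PP: "(preim C P \<pi> L, P) \<in> \<P>'"
      using P sub by (auto simp: presentation_def surj_arr_def)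
    let ?K = "a_kernel (Und C P) (Und C M) \<pi>"
    have im: "\<pi> ` preim C P \<pi> L = L" using preim_image_eq[OF \<pi>s subM[OF LM]] .
    \<comment> \<open>Zero lies in \<open>L\<close>, so the kernel lies in the preimage of
      \<open>L\<close>: the chain of submodules that cohereditariness asks for.\<close>
    have "?K \<subseteq> preim C P \<pi> L"
      using submod_zero[OF pair_class_submod[OF pairs' LM]] by (auto simp: a_kernel_def' preim_def)
    \<comment> \<open>Cohereditariness is applied to \<open>P\<close> modulo \<open>?K\<close>,
      where the quotient map is \<open>\<pi>\<close> itself and takes the preimage of
      \<open>L\<close> onto \<open>L\<close>. The pair on \<open>P\<close> is in the domain of
      \<open>p\<close> because \<open>\<P>\<close> lies in \<open>\<P>'\<close>.\<close>
    then have "p (L, M) = \<pi> ` (p (preim C P \<pi> L, P) <+>\<^bsub>Und C P\<^esub> ?K)"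
      using cohereditaryD[OF coh surj_arr_is_quotient[OF \<pi>s] _ PP] im LM by simp
    also have "\<dots> = \<pi> ` p (preim C P \<pi> L, P)"
      by (rule image_add_kernel[OF \<pi>
            module.submoduleE(1)[OF arr_Und_module(1)[OF \<pi>] pair_operation_submodule[OF p PP]]])
    finally show ?thesis using eq by simp
  qed
  show ?thesis
    using indep pair_op cohered cofun unique by auto
qed

end
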